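(* Let $\tau > 0$, let $M \in \mathbb{R}^{n\times n}$ be a symmetric positive definite matrix, let $K \in \mathbb{R}^{n\times n}$, and put $A = \tau M^{-1}K$ and $\hat{A} = M^{1/2} A M^{-1/2}$. Define $$D := \frac{1}{2}(K + K^\top), \qquad C := \frac{1}{2\mathrm{i}}(K - K^\top).$$ Then the left endpoint $\min\{\mathrm{Re}(z) : z \in \mathcal{W}(\hat{A})\}$ (respectively, the right endpoint $\max\{\mathrm{Re}(z) : z \in \mathcal{W}(\hat{A})\}$) of $\mathcal{W}(\hat{A})$ is the minimum (respectively, maximum) eigenvalue of the generalized eigenvalue problem $(\tau D)x = \lambda M x$. Similarly, the top endpoint $\max\{\mathrm{Im}(z) : z \in \mathcal{W}(\hat{A})\}$ (respectively, the bottom endpoint $\min\{\mathrm{Im}(z) : z \in \mathcal{W}(\hat{A})\}$) of $\mathcal{W}(\hat{A})$ is the maximum (respectively, minimum) eigenvalue of the generalized eigenvalue problem $(\tau C)x = \lambda M x$.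
   Context: For a square matrix $B \in \mathbb{C}^{n\times n}$, the numerical range (field of values) is $\mathcal{W}(B) = \{v^\ast B v : v \in \mathbb{C}^n, \|v\|_2 = 1\}$. $M^{1/2}$ denotes the symmetric positive definite square root of $M$ and $M^{-1/2}$ its inverse. An eigenvalue of the generalized eigenvalue problem $Bx = \lambda Mx$ is a scalar $\lambda$ for which this equation has a solution $x \in \mathbb{C}^n$, $x \neq 0$; for $B=\tau D$ and $B=\tau C$ (Hermitian) and $M$ symmetric positive definite all such $\lambda$ are real. $\mathrm{i}$ is the imaginary unit. *)

theory Defs
  imports "HOL-Analysis.Analysis"
begin

definition sym_pos_def :: "real^'n^'n \<Rightarrow> bool" where
  "sym_pos_def M \<longleftrightarrow> transpose M = M \<and> (\<forall>x. x \<noteq> 0 \<longrightarrow> 0 < x \<bullet> (M *v x))"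

definition spd_sqrt :: "real^'n^'n \<Rightarrow> real^'n^'n" where
  "spd_sqrt M = (THE S. sym_pos_def S \<and> S ** S = M)"

abbreviation cmatrix :: "real^'n^'m \<Rightarrow> complex^'n^'m" where
  "cmatrix \<equiv> map_matrix complex_of_real"

(* The norm on complex^'n is the Euclidean norm; the sum is v^* B v. *)
definition numerical_range :: "complex^'n^'n \<Rightarrow> complex set" where
  "numerical_range B = {(\<Sum>i\<in>UNIV. cnj (v $ i) * (B *v v) $ i) | v. norm v = 1}"

definition gen_eigenvalues :: "complex^'n^'n \<Rightarrow> complex^'n^'n \<Rightarrow> complex set" where
  "gen_eigenvalues B M = {\<mu>. \<exists>x. x \<noteq> 0 \<and> B *v x = \<mu> *s (M *v x)}"

(* Min and Max are only meaningful on finite sets and Inf and Sup need not be attained,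
   so attained extrema are expressed relationally. *)
definition is_minimum :: "real set \<Rightarrow> real \<Rightarrow> bool" where
  "is_minimum S m \<longleftrightarrow> m \<in> S \<and> (\<forall>x\<in>S. m \<le> x)"

definition is_maximum :: "real set \<Rightarrow> real \<Rightarrow> bool" where
  "is_maximum S m \<longleftrightarrow> m \<in> S \<and> (\<forall>x\<in>S. x \<le> m)"

(* Extremal eigenvalues are only meaningful for a real spectrum, so this is part of the notion. *)
definition is_min_gen_eigenvalue :: "complex^'n^'n \<Rightarrow> complex^'n^'n \<Rightarrow> real \<Rightarrow> bool" where
  "is_min_gen_eigenvalue B M m \<longleftrightarrow>
     gen_eigenvalues B M \<subseteq> \<real> \<and> is_minimum {r. complex_of_real r \<in> gen_eigenvalues B M} m"

definition is_max_gen_eigenvalue :: "complex^'n^'n \<Rightarrow> complex^'n^'n \<Rightarrow> real \<Rightarrow> bool" where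
  "is_max_gen_eigenvalue B M m \<longleftrightarrow>
     gen_eigenvalues B M \<subseteq> \<real> \<and> is_maximum {r. complex_of_real r \<in> gen_eigenvalues B M} m"

end

theory Submission
  imports Defs
begin

text \<open>
  Up to the congruence by \<open>M\<^sup>-\<^sup>1\<^sup>/\<^sup>2\<close>, the real part of the quadratic form of \<open>Ahat\<close> is the form
  of a Hermitian matrix whose eigenvalues are the generalized eigenvalues of \<open>(\<tau> D, M)\<close>. A form of a
  self-adjoint operator attains its extrema over the unit sphere at eigenvectors, since
  \<open>m \<bar>x\<bar>\<^sup>2 - \<langle>x, f x\<rangle>\<close> is then a semidefinite form with a zero. The imaginary part is the
  real part of the form of \<open>-\<i> Ahat\<close>. Throughout, \<open>\<complex>\<^sup>n\<close> is treated as a real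
  Euclidean space with inner product \<open>Re (v\<^sup>* w)\<close>, for which Hermitian matrices are self-adjoint.
\<close>

section \<open>Spectral theorem for self-adjoint operators on real Euclidean spaces\<close>

text \<open>By compactness the form attains a maximum on the unit sphere of \<open>U\<close>, and a
  first-order variation shows that the maximizer is an eigenvector. Working in an invariant subspace
  prepares the induction in \<open>self_adjoint_eigenbasis\<close>; the extremal eigenvalues come
  from \<open>U = UNIV\<close>.\<close>

lemma self_adjoint_max_eigenvector:
  fixes f :: "'a::euclidean_space \<Rightarrow> 'a"
  assumes f: "linear f" and sa: "\<And>x y. x \<bullet> f y = f x \<bullet> y"
    and U: "subspace U" "f ` U \<subseteq> U" "U \<noteq> {0}"
  obtains v m where "v \<in> U" "norm v = 1" "f v = m *\<^sub>R v"
    "\<And>x. x \<in> U \<Longrightarrow> x \<bullet> f x \<le> m * (x \<bullet> x)"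
proof -
  define K where "K = sphere 0 1 \<inter> U"
  have "compact K"
    unfolding K_def using U(1) by (intro compact_Int_closed closed_subspace) auto
  moreover have "K \<noteq> {}"
  proof -
    obtain u where "u \<in> U" "u \<noteq> 0"
      using U subspace_0 by blast
    then have "(1 / norm u) *\<^sub>R u \<in> K"
      by (simp add: K_def U(1) subspace_scale)
    then show ?thesis by blast
  qed
  moreover have "continuous_on K (\<lambda>x. x \<bullet> f x)"
    using f by (intro continuous_on_inner continuous_on_id linear_continuous_on)
      (simp add: linear_conv_bounded_linear)
  ultimately obtain v where v: "v \<in> K" "\<And>x. x \<in> K \<Longrightarrow> x \<bullet> f x \<le> v \<bullet> f v"
    using continuous_attains_sup[of K "\<lambda>x. x \<bullet> f x"] by blast
  define m where "m = v \<bullet> f v"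
  have vU: "v \<in> U" and nv: "norm v = 1" and vv: "v \<bullet> v = 1"
    using v(1) by (auto simp: K_def dot_square_norm)
  have bound: "x \<bullet> f x \<le> m * (x \<bullet> x)" if "x \<in> U" for x
  proof (cases "x = 0")
    case False
    then have "(1 / norm x) *\<^sub>R x \<in> K"
      using that by (simp add: K_def U(1) subspace_scale)
    then have "((1 / norm x) *\<^sub>R x) \<bullet> f ((1 / norm x) *\<^sub>R x) \<le> m"
      unfolding m_def by (rule v(2))
    with False show ?thesis
      by (simp add: linear_scale[OF f] field_simps dot_square_norm power2_eq_square)
  qed (simp add: linear_0[OF f])
  \<comment> \<open>The residual \<open>w\<close> of the eigenvalue equation also serves as the
    direction of variation: along \<open>v + t w\<close> the nonnegative form
    \<open>m (x \<bullet> x) - x \<bullet> f x\<close> starts at 0 with slope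
    \<open>2 (w \<bullet> w)\<close>, while \<open>c\<close> is its value at
    \<open>w\<close>.\<close>
  define w where "w = m *\<^sub>R v - f v"
  define c where "c = m * (w \<bullet> w) - w \<bullet> f w"
  have wU: "w \<in> U"
    using U vU by (auto simp: w_def intro!: subspace_diff subspace_scale)
  then have c: "c \<ge> 0"
    using bound by (simp add: c_def)
  have quad: "0 \<le> 2 * t * (w \<bullet> w) + t\<^sup>2 * c" for t
  proof -
    have "v + t *\<^sub>R w \<in> U"
      using U(1) vU wU by (simp add: subspace_add subspace_scale)
    from bound[OF this] have "0 \<le> m * ((v + t *\<^sub>R w) \<bullet> (v + t *\<^sub>R w)) - (v + t *\<^sub>R w) \<bullet> f (v + t *\<^sub>R w)"
      by simp
    also have "\<dots> = (m * (v \<bullet> v) - v \<bullet> f v) + 2 * t * (w \<bullet> (m *\<^sub>R v - f v)) + t\<^sup>2 * c"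
      using sa[of v w]
      by (simp add: c_def linear_add[OF f] linear_scale[OF f] inner_simps inner_commute
          power2_eq_square algebra_simps)
    finally show ?thesis
      by (simp add: vv m_def w_def)
  qed
  have "w \<bullet> w = 0"
  proof (rule ccontr)
    assume "w \<bullet> w \<noteq> 0"
    then have a: "w \<bullet> w > 0" by simp
    \<comment> \<open>A negative \<open>t\<close> small enough for the linear term to dominate. The
      denominator \<open>c + 1\<close> stays positive even when \<open>c = 0\<close>.\<close>
    define t where "t = - (w \<bullet> w) / (c + 1)"
    have "t * (c + 1) = - (w \<bullet> w)"
      using c by (simp add: t_def)
    then have "(c + 1)\<^sup>2 * (2 * t * (w \<bullet> w) + t\<^sup>2 * c) = - ((w \<bullet> w)\<^sup>2 * (c + 2))"
      by algebra
    moreover have "(w \<bullet> w)\<^sup>2 * (c + 2) > 0"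
      using a c by simp
    moreover have "0 \<le> (c + 1)\<^sup>2 * (2 * t * (w \<bullet> w) + t\<^sup>2 * c)"
      using quad by simp
    ultimately show False by linarith
  qed
  then have "f v = m *\<^sub>R v"
    by (simp add: w_def)
  with that vU nv bound show ?thesis by blast
qed

text \<open>Induction on the dimension: split off a unit eigenvector \<open>v\<close>. Its
  orthogonal complement in \<open>U\<close> is again invariant, because
  \<open>v \<bullet> f x = f v \<bullet> x\<close> is a multiple of
  \<open>v \<bullet> x\<close>.\<close>

lemma self_adjoint_eigenbasis:
  fixes f :: "'a::euclidean_space \<Rightarrow> 'a"
  assumes f: "linear f" and sa: "\<And>x y. x \<bullet> f y = f x \<bullet> y"
    and U: "subspace U" "f ` U \<subseteq> U"
  shows "\<exists>B. pairwise orthogonal B \<and> (\<forall>b\<in>B. norm b = 1 \<and> (\<exists>l. f b = l *\<^sub>R b)) \<and> span B = U"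
  using U
proof (induction "dim U" arbitrary: U rule: less_induct)
  case less
  show ?case
  proof (cases "U = {0}")
    case True
    then show ?thesis by (intro exI[of _ "{}"]) auto
  next
    case False
    then obtain v m where v: "v \<in> U" "norm v = 1" "f v = m *\<^sub>R v"
      using self_adjoint_max_eigenvector[OF f sa less.prems] by metis
    have vv: "v \<bullet> v = 1" using v(2) by (simp add: dot_square_norm)
    define V where "V = {x \<in> U. v \<bullet> x = 0}"
    have V: "subspace V"
      using less.prems(1) by (auto simp: V_def subspace_def inner_simps)
    have fV: "f ` V \<subseteq> V"
      using less.prems(2) v(3) by (auto simp: V_def sa)
    have "V \<subset> U"
    proof -
      have "v \<notin> V" using vv by (simp only: V_def) simp
      moreover have "V \<subseteq> U" by (auto simp: V_def)
      ultimately show ?thesis using v(1) by blast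
    qed
    then have "dim V < dim U"
      using V less.prems(1) by (intro dim_psubset) (simp add: span_eq_iff[THEN iffD2])
    from less.hyps[OF this V fV] obtain B where
      B: "pairwise orthogonal B" "\<forall>b\<in>B. norm b = 1 \<and> (\<exists>l. f b = l *\<^sub>R b)" "span B = V"
      by blast
    have BV: "B \<subseteq> V" using B(3) span_superset by blast
    have "pairwise orthogonal (insert v B)"
      using B(1) BV by (auto simp: pairwise_insert V_def orthogonal_def inner_commute)
    moreover have "span (insert v B) = U"
    proof
      show "span (insert v B) \<subseteq> U"
        using BV v(1) less.prems(1) by (intro span_minimal) (auto simp: V_def)
      show "U \<subseteq> span (insert v B)"
      proof
        fix x assume "x \<in> U"
        then have "x - (v \<bullet> x) *\<^sub>R v \<in> V"
          using v(1) vv less.prems(1)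
          by (auto simp: V_def inner_simps intro!: subspace_diff subspace_scale)
        then show "x \<in> span (insert v B)"
          using B(3) by (auto simp: span_insert)
      qed
    qed
    ultimately show ?thesis
      using B(2) v by (intro exI[of _ "insert v B"]) auto
  qed
qed

section \<open>Existence and uniqueness of the positive definite square root\<close>

lemma transpose_eq_iff_self_adjoint:
  fixes S :: "real^'n^'n"
  shows "transpose S = S \<longleftrightarrow> (\<forall>x y. x \<bullet> (S *v y) = (S *v x) \<bullet> y)"
proof
  assume "transpose S = S"
  then show "\<forall>x y. x \<bullet> (S *v y) = (S *v x) \<bullet> y"
    by (metis dot_lmul_matrix transpose_matrix_vector)
next
  assume sa: "\<forall>x y. x \<bullet> (S *v y) = (S *v x) \<bullet> y"
  have "transpose S *v x = S *v x" for x
    by (rule vector_eq_rdot[THEN iffD1])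
      (use sa in \<open>simp add: dot_lmul_matrix\<close>)
  then show "transpose S = S" by (simp add: matrix_eq)
qed

text \<open>On an orthonormal eigenbasis of \<open>M\<close>, each eigenvalue is replaced by its
  square root.\<close>

lemma spd_sqrt_exists:
  assumes "sym_pos_def M"
  shows "\<exists>S. sym_pos_def S \<and> S ** S = M"
proof -
  have sa: "x \<bullet> (M *v y) = (M *v x) \<bullet> y" for x y
    using assms by (simp add: sym_pos_def_def transpose_eq_iff_self_adjoint)
  have pos: "x \<noteq> 0 \<Longrightarrow> 0 < x \<bullet> (M *v x)" for x
    using assms by (simp add: sym_pos_def_def)
  obtain B where B: "pairwise orthogonal B" "\<forall>b\<in>B. norm b = 1 \<and> (\<exists>l. M *v b = l *\<^sub>R b)"
    "span B = UNIV"
    using self_adjoint_eigenbasis[of "(*v) M" UNIV] sa by auto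
  \<comment> \<open>For a unit eigenvector the value of the form is the eigenvalue itself, which
    gives an explicit eigenvalue function on \<open>B\<close>.\<close>
  define l where "l b = b \<bullet> (M *v b)" for b
  have B1: "b \<bullet> b = 1" "b \<noteq> 0" if "b \<in> B" for b
    using B(2) that by (auto simp: dot_square_norm)
  have Mb: "M *v b = l b *\<^sub>R b" if "b \<in> B" for b
    using B(2) B1[OF that] that by (fastforce simp: l_def)
  have lpos: "l b > 0" if "b \<in> B" for b
    using pos B1[OF that] by (simp add: l_def)
  have fin: "finite B"
    using B(1) B1 by (intro independent_imp_finite pairwise_orthogonal_independent) auto
  define g where "g x = (\<Sum>b\<in>B. (sqrt (l b) * (b \<bullet> x)) *\<^sub>R b)" for x
  have g: "linear g"
    by (rule linearI)
      (simp_all add: g_def inner_simps algebra_simps sum.distrib scaleR_sum_right)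
  have gb: "g b = sqrt (l b) *\<^sub>R b" if "b \<in> B" for b
  proof -
    have "g b = (\<Sum>c\<in>B. if c = b then sqrt (l b) *\<^sub>R b else 0)"
      unfolding g_def using B(1) that B1
      by (intro sum.cong) (auto simp: pairwise_def orthogonal_def)
    then show ?thesis using fin that by simp
  qed
  define S where "S = matrix g"
  have Sg: "S *v x = g x" for x
    using matrix_vector_mul(2)[OF g] by (simp add: S_def)
  have form: "x \<bullet> g y = (\<Sum>b\<in>B. sqrt (l b) * (b \<bullet> x) * (b \<bullet> y))" for x y
    by (simp add: g_def inner_sum_right inner_commute mult_ac)
  have "transpose S = S"
    unfolding transpose_eq_iff_self_adjoint Sg
  proof (intro allI)
    fix x y
    show "x \<bullet> g y = g x \<bullet> y"
      unfolding inner_commute[of "g x" y] form by (simp add: mult_ac)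
  qed
  moreover have "0 < x \<bullet> (S *v x)" if "x \<noteq> 0" for x
  proof -
    \<comment> \<open>Some term of the sum of squares below must be strictly positive: otherwise
      \<open>x\<close> would be orthogonal to \<open>span B = UNIV\<close>, hence to itself.\<close>
    have "\<exists>b\<in>B. b \<bullet> x \<noteq> 0"
    proof (rule ccontr)
      assume "\<not> (\<exists>b\<in>B. b \<bullet> x \<noteq> 0)"
      then have "orthogonal x b" if "b \<in> B" for b
        unfolding orthogonal_def inner_commute[of x] using that by blast
      then have "orthogonal x x"
        using B(3) by (intro orthogonal_to_span[of x B]) auto
      then show False using \<open>x \<noteq> 0\<close> by (simp add: orthogonal_self)
    qed
    then obtain b where b: "b \<in> B" "b \<bullet> x \<noteq> 0" by blast
    have "0 < (\<Sum>b\<in>B. sqrt (l b) * (b \<bullet> x)\<^sup>2)"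
      using b fin lpos by (intro sum_pos2[of _ b]) (auto simp: less_imp_le)
    then show ?thesis by (simp add: Sg form power2_eq_square mult.assoc)
  qed
  moreover have "S ** S = M"
  proof -
    have "(S ** S) *v b = M *v b" if "b \<in> B" for b
      using that lpos[of b] gb
      by (simp add: Mb Sg linear_scale[OF g] flip: matrix_vector_mul_assoc)
    then have "(S ** S) *v x = M *v x" for x
      using B(3) linear_eq_on_span[of "(*v) (S ** S)" "(*v) M" B x] by simp
    then show ?thesis by (simp add: matrix_eq)
  qed
  ultimately show ?thesis by (auto simp: sym_pos_def_def)
qed

text \<open>By linearity it suffices that \<open>S\<close> and \<open>T\<close> agree on an
  eigenbasis of \<open>T\<close>. With existence, this makes the definite description in
  \<open>spd_sqrt\<close> meaningful.\<close>

lemma spd_sqrt_unique: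
  assumes S: "sym_pos_def S" and T: "sym_pos_def T" and ST: "S ** S = T ** T"
  shows "S = T"
proof -
  have "x \<bullet> (T *v y) = (T *v x) \<bullet> y" for x y
    using T by (simp add: sym_pos_def_def transpose_eq_iff_self_adjoint)
  then obtain B where B: "\<forall>b\<in>B. norm b = 1 \<and> (\<exists>l. T *v b = l *\<^sub>R b)" "span B = UNIV"
    using self_adjoint_eigenbasis[of "(*v) T" UNIV] by auto
  have "S *v b = T *v b" if "b \<in> B" for b
  proof -
    from B that obtain l where l: "T *v b = l *\<^sub>R b" and b: "b \<noteq> 0" by force
    have "0 < b \<bullet> (T *v b)"
      using T b by (simp add: sym_pos_def_def)
    then have "l > 0"
      using zero_less_mult_pos2[of l "b \<bullet> b"] b by (simp only: l inner_scaleR_right) simp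
    \<comment> \<open>\<open>(S + l) (S - l) b = 0\<close>, and \<open>S + l\<close> is positive definite.\<close>
    define w where "w = S *v b - l *\<^sub>R b"
    have "S *v (S *v b) = T *v (T *v b)"
      using ST by (simp add: matrix_vector_mul_assoc)
    then have "S *v w = - (l *\<^sub>R w)"
      by (simp add: w_def l algebra_simps)
    then have "w \<bullet> (S *v w) \<le> 0"
      using \<open>l > 0\<close> by simp
    then have "w = 0"
      using S unfolding sym_pos_def_def by (meson not_le)
    then show ?thesis by (simp add: w_def l)
  qed
  then have "S *v x = T *v x" for x
    using B(2) linear_eq_on_span[of "(*v) S" "(*v) T" B x] by simp
  then show ?thesis by (simp add: matrix_eq)
qed

lemma
  assumes "sym_pos_def M"
  shows sym_pos_def_spd_sqrt: "sym_pos_def (spd_sqrt M)"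
    and spd_sqrt_square: "spd_sqrt M ** spd_sqrt M = M"
proof -
  have "\<exists>!S. sym_pos_def S \<and> S ** S = M"
    using spd_sqrt_exists[OF assms] spd_sqrt_unique by metis
  from theI'[OF this]
  show "sym_pos_def (spd_sqrt M)" "spd_sqrt M ** spd_sqrt M = M"
    by (simp_all add: spd_sqrt_def)
qed

section \<open>Inverses of positive definite and symmetric matrices\<close>

lemma
  fixes A :: "'a::semiring_1^'n^'m"
  assumes "invertible A"
  shows matrix_mul_matrix_inv: "A ** matrix_inv A = mat 1"
    and matrix_inv_mul_matrix: "matrix_inv A ** A = mat 1"
  using someI_ex[OF assms[unfolded invertible_def]] by (simp_all add: matrix_inv_def)

lemma sym_pos_def_invertible:
  assumes "sym_pos_def M"
  shows "invertible M"
proof -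
  have "x = 0" if "M *v x = 0" for x
  proof (rule ccontr)
    assume "x \<noteq> 0"
    then have "0 < x \<bullet> (M *v x)" using assms by (simp add: sym_pos_def_def)
    with that show False by simp
  qed
  then show ?thesis
    unfolding invertible_left_inverse matrix_left_invertible_ker by blast
qed

lemma matrix_inv_self_adjoint:
  fixes S :: "real^'n^'n"
  assumes "transpose S = S" "invertible S"
  shows "transpose (matrix_inv S) = matrix_inv S"
  unfolding transpose_eq_iff_self_adjoint
proof (intro allI)
  fix x y
  let ?R = "matrix_inv S"
  have SR: "S *v (?R *v z) = z" for z
    using assms(2) by (simp add: matrix_vector_mul_assoc matrix_mul_matrix_inv)
  show "x \<bullet> (?R *v y) = (?R *v x) \<bullet> y"
    using assms(1)[unfolded transpose_eq_iff_self_adjoint, rule_format, of "?R *v x" "?R *v y"]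
    by (simp add: SR)
qed

section \<open>Complexification, Hermitian matrices and the numerical range\<close>

lemma cmatrix_mult: "cmatrix (A ** B) = cmatrix A ** cmatrix B"
  by (simp add: vec_eq_iff matrix_matrix_mult_def)

lemma cmatrix_mat_1: "cmatrix (mat 1) = mat 1"
  by (simp add: vec_eq_iff mat_def)

text \<open>In the real inner product on the complex numbers, multiplication by a scalar has
  multiplication by its conjugate as adjoint; Hermitian symmetry then exchanges the two indices of
  the double sum.\<close>

lemma hermitian_self_adjoint:
  fixes H :: "complex^'n^'n"
  assumes "\<And>i j. H $ i $ j = cnj (H $ j $ i)"
  shows "x \<bullet> (H *v y) = (H *v x) \<bullet> y"
proof -
  have "x \<bullet> (H *v y) = (\<Sum>i\<in>UNIV. \<Sum>j\<in>UNIV. x $ i \<bullet> (H $ i $ j * y $ j))"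
    by (simp add: inner_vec_def matrix_vector_mult_def inner_sum_right)
  also have "\<dots> = (\<Sum>i\<in>UNIV. \<Sum>j\<in>UNIV. (H $ j $ i * x $ i) \<bullet> y $ j)"
  proof (intro sum.cong refl)
    fix i j
    show "x $ i \<bullet> (H $ i $ j * y $ j) = (H $ j $ i * x $ i) \<bullet> y $ j"
      using assms[of i j] by (simp add: inner_complex_def algebra_simps)
  qed
  also have "\<dots> = (\<Sum>j\<in>UNIV. \<Sum>i\<in>UNIV. (H $ j $ i * x $ i) \<bullet> y $ j)"
    by (rule sum.swap)
  also have "\<dots> = (H *v x) \<bullet> y"
    by (simp add: inner_vec_def matrix_vector_mult_def inner_sum_left)
  finally show ?thesis .
qed

lemma Re_numerical_range:
  "Re ` numerical_range A = {v \<bullet> (A *v v) | v. norm v = 1}"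
proof -
  have "Re (\<Sum>i\<in>UNIV. cnj (v $ i) * (A *v v) $ i) = v \<bullet> (A *v v)" for v
    by (simp add: inner_vec_def inner_complex_def)
  then show ?thesis
    by (force simp: numerical_range_def image_iff)
qed

lemma Im_numerical_range:
  "Im ` numerical_range A = {v \<bullet> (- \<i> *s (A *v v)) | v. norm v = 1}"
proof -
  have "Im (\<Sum>i\<in>UNIV. cnj (v $ i) * (A *v v) $ i) = v \<bullet> (- \<i> *s (A *v v))" for v
    by (simp add: inner_vec_def inner_complex_def algebra_simps)
  then show ?thesis
    by (force simp: numerical_range_def image_iff)
qed

lemma complex_of_real_vector_smult: "complex_of_real r *s v = r *\<^sub>R (v :: complex^'n)"
  by (simp add: vec_eq_iff) (simp add: scaleR_conv_of_real)

section \<open>Extremal eigenvalues of self-adjoint complex matrices\<close>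

text \<open>Since \<open>H\<close> commutes with multiplication by \<open>\<i>\<close>, testing
  self-adjointness on \<open>x\<close> and \<open>\<i> *s x\<close> equates
  \<open>Im \<mu> * (x \<bullet> x)\<close> with its negative. Normalizing the eigenvector then
  shows that the eigenvalue is a value of the form on the unit sphere.\<close>

lemma self_adjoint_eigenvalue:
  fixes H :: "complex^'n^'n"
  assumes sa: "\<And>x y. x \<bullet> (H *v y) = (H *v x) \<bullet> y" and mu: "\<mu> \<in> gen_eigenvalues H (mat 1)"
  shows "\<mu> \<in> \<real>" "\<exists>v. norm v = 1 \<and> v \<bullet> (H *v v) = Re \<mu>"
proof -
  from mu obtain x where x: "x \<noteq> 0" "H *v x = \<mu> *s x"
    by (auto simp: gen_eigenvalues_def)
  have form: "x \<bullet> (a *s x) = Re a * (x \<bullet> x)" "(a *s x) \<bullet> x = Re a * (x \<bullet> x)" for a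
    by (simp_all add: inner_vec_def inner_complex_def sum_distrib_left algebra_simps)
  have "(\<mu> *s x) \<bullet> (\<i> *s x) = Im \<mu> * (x \<bullet> x)"
    by (simp add: inner_vec_def inner_complex_def sum_distrib_left algebra_simps)
  moreover have "x \<bullet> (H *v (\<i> *s x)) = x \<bullet> ((\<i> * \<mu>) *s x)"
    by (simp add: vector_scalar_commute x)
  ultimately have "Im \<mu> * (x \<bullet> x) = - Im \<mu> * (x \<bullet> x)"
    using sa[of x "\<i> *s x"] form(1)[of "\<i> * \<mu>"] by (simp add: x)
  then show "\<mu> \<in> \<real>"
    using x(1) by (simp add: complex_is_Real_iff)
  define v where "v = (1 / norm x) *\<^sub>R x"
  have "norm v = 1" using x(1) by (simp add: v_def)
  moreover have "v \<bullet> (H *v v) = Re \<mu>"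
    using x(1)
    by (simp add: v_def linear_scale[OF matrix_vector_mul_linear] x(2)
        form dot_square_norm power2_eq_square)
  ultimately show "\<exists>v. norm v = 1 \<and> v \<bullet> (H *v v) = Re \<mu>" by blast
qed

text \<open>All eigenvalues lie in \<open>W\<close>, and each extremum of \<open>W\<close> is
  attained at an eigenvector, so it is also the extremum of the smaller set of eigenvalues.\<close>

lemma self_adjoint_extremal_eigenvalues:
  fixes H :: "complex^'n^'n"
  assumes sa: "\<And>x y. x \<bullet> (H *v y) = (H *v x) \<bullet> y"
  defines "W \<equiv> {v \<bullet> (H *v v) | v. norm v = 1}"
  shows "\<exists>m. is_minimum W m \<and> is_min_gen_eigenvalue H (mat 1) m"
    and "\<exists>m. is_maximum W m \<and> is_max_gen_eigenvalue H (mat 1) m"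
proof -
  let ?E = "{r. complex_of_real r \<in> gen_eigenvalues H (mat 1)}"
  have real: "gen_eigenvalues H (mat 1) \<subseteq> \<real>"
    using self_adjoint_eigenvalue(1)[OF sa] by blast
  have EW: "?E \<subseteq> W"
    using self_adjoint_eigenvalue(2)[OF sa] by (fastforce simp: W_def)
  have mem: "m \<in> W" "m \<in> ?E" if "norm v = 1" "H *v v = m *\<^sub>R v" for m v
    using that by (auto simp: W_def gen_eigenvalues_def complex_of_real_vector_smult dot_square_norm
        intro!: exI[of _ v])
  have U: "(UNIV :: (complex^'n) set) \<noteq> {0}"
    using UNIV_not_singleton by blast
  have sa': "x \<bullet> - (H *v y) = - (H *v x) \<bullet> y" for x y
    by (simp add: sa)
  obtain v m where v: "norm v = 1" "H *v v = m *\<^sub>R v" "\<And>x. x \<bullet> (H *v x) \<le> m * (x \<bullet> x)"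
    using self_adjoint_max_eigenvector[of "(*v) H" UNIV] sa U by auto
  have "x \<bullet> (H *v x) \<le> m" if "norm x = 1" for x
    using v(3)[of x] that by (simp add: dot_square_norm)
  then have "is_maximum W m"
    using mem(1)[OF v(1,2)] by (auto simp: is_maximum_def W_def)
  moreover from this have "is_maximum ?E m"
    using mem(2)[OF v(1,2)] EW by (auto simp: is_maximum_def)
  ultimately show "\<exists>m. is_maximum W m \<and> is_max_gen_eigenvalue H (mat 1) m"
    using real by (auto simp: is_max_gen_eigenvalue_def)
  \<comment> \<open>The minimum comes from the maximum principle for \<open>- H\<close>, so the
    eigenvalue of \<open>H\<close> is \<open>- m\<close>.\<close>
  obtain v m where v: "norm v = 1" "- (H *v v) = m *\<^sub>R v" "\<And>x. x \<bullet> - (H *v x) \<le> m * (x \<bullet> x)"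
    using self_adjoint_max_eigenvector[of "\<lambda>x. - (H *v x)" UNIV] sa' U
    by (auto simp: linear_compose_neg)
  from v(2) have v2: "H *v v = (- m) *\<^sub>R v"
    by (metis minus_minus scaleR_minus_left)
  have "- m \<le> x \<bullet> (H *v x)" if "norm x = 1" for x
    using v(3)[of x] that by (simp add: dot_square_norm)
  then have "is_minimum W (- m)"
    using mem(1)[OF v(1) v2] by (auto simp: is_minimum_def W_def)
  moreover from this have "is_minimum ?E (- m)"
    using mem(2)[OF v(1) v2] EW by (auto simp: is_minimum_def)
  ultimately show "\<exists>m. is_minimum W m \<and> is_min_gen_eigenvalue H (mat 1) m"
    using real by (auto simp: is_min_gen_eigenvalue_def)
qed

section \<open>From generalized to ordinary eigenvalues by congruence\<close>

text \<open>The substitution \<open>y = S *v x\<close>, with inverse \<open>x = R *v y\<close>,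
  carries eigenvectors of one problem to eigenvectors of the other with the same eigenvalue.\<close>

lemma gen_eigenvalues_congruence:
  assumes SR: "S ** R = mat 1" and RS: "R ** S = mat 1"
  shows "gen_eigenvalues B (S ** S) = gen_eigenvalues (R ** B ** R) (mat 1)"
proof -
  have SR': "S *v (R *v x) = x" and RS': "R *v (S *v x) = x" for x
    by (simp_all add: matrix_vector_mul_assoc SR RS)
  have mul: "(X ** Y) *v x = X *v (Y *v x)" for X Y :: "complex^'a^'a" and x
    by (simp add: matrix_vector_mul_assoc)
  show ?thesis
  proof (intro set_eqI iffI)
    fix \<mu> assume "\<mu> \<in> gen_eigenvalues B (S ** S)"
    then obtain x where x: "x \<noteq> 0" "B *v x = \<mu> *s (S *v (S *v x))"
      by (auto simp: gen_eigenvalues_def mul)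
    then have "S *v x \<noteq> 0" "(R ** B ** R) *v (S *v x) = \<mu> *s (S *v x)"
      using RS'[of x]
      by (metis matrix_vector_mult_0_right, simp add: mul RS' vector_scalar_commute)
    then show "\<mu> \<in> gen_eigenvalues (R ** B ** R) (mat 1)"
      by (auto simp: gen_eigenvalues_def)
  next
    fix \<mu> assume "\<mu> \<in> gen_eigenvalues (R ** B ** R) (mat 1)"
    then obtain y where y: "y \<noteq> 0" "R *v (B *v (R *v y)) = \<mu> *s y"
      by (auto simp: gen_eigenvalues_def mul)
    then have "R *v y \<noteq> 0" "B *v (R *v y) = \<mu> *s ((S ** S) *v (R *v y))"
      using SR'[of y] SR'[of "B *v (R *v y)"]
      by (metis matrix_vector_mult_0_right, metis mul SR' vector_scalar_commute)
    then show "\<mu> \<in> gen_eigenvalues B (S ** S)"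
      by (auto simp: gen_eigenvalues_def)
  qed
qed

text \<open>The form of \<open>R ** B ** R\<close> at \<open>v\<close> is the form of
  \<open>B\<close> at \<open>R *v v\<close>. The set \<open>W\<close> is written in the latter way
  so that it matches the real and imaginary parts of the form of \<open>Ahat\<close>.\<close>

lemma congruent_extremal_eigenvalues:
  fixes B N R S :: "complex^'n^'n"
  assumes B: "\<And>x y. x \<bullet> (B *v y) = (B *v x) \<bullet> y" and R: "\<And>x y. x \<bullet> (R *v y) = (R *v x) \<bullet> y"
    and SR: "S ** R = mat 1" and RS: "R ** S = mat 1"
  defines "W \<equiv> {(R *v v) \<bullet> (B *v (R *v v)) | v. norm v = 1}"
  shows "\<exists>m. is_minimum W m \<and> is_min_gen_eigenvalue B (S ** S) m"
    and "\<exists>m. is_maximum W m \<and> is_max_gen_eigenvalue B (S ** S) m"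
proof -
  let ?H = "R ** B ** R"
  have H: "x \<bullet> (?H *v y) = (R *v x) \<bullet> (B *v (R *v y))" for x y
    by (simp add: R flip: matrix_vector_mul_assoc)
  have "x \<bullet> (?H *v y) = (?H *v x) \<bullet> y" for x y
    by (metis B H inner_commute)
  from self_adjoint_extremal_eigenvalues[of ?H, OF this]
  show "\<exists>m. is_minimum W m \<and> is_min_gen_eigenvalue B (S ** S) m"
    and "\<exists>m. is_maximum W m \<and> is_max_gen_eigenvalue B (S ** S) m"
    by (simp_all add: H W_def is_min_gen_eigenvalue_def is_max_gen_eigenvalue_def
        gen_eigenvalues_congruence[OF SR RS])
qed

section \<open>Splitting the form of the transformed matrix into its real and imaginary
  parts\<close>

theorem proposition2:
  fixes \<tau> :: real and M K A Ahat D :: "real^'n^'n" and C :: "complex^'n^'n"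
  assumes "\<tau> > 0"
    and "sym_pos_def M"
    and "A = \<tau> *\<^sub>R (matrix_inv M ** K)"
    and "Ahat = spd_sqrt M ** A ** matrix_inv (spd_sqrt M)"
    and "D = (1 / 2) *\<^sub>R (K + transpose K)"
    and "C = map_matrix (\<lambda>z. 1 / (2 * \<i>) * z) (cmatrix (K - transpose K))"
  shows "(\<exists>m. is_minimum (Re ` numerical_range (cmatrix Ahat)) m \<and>
              is_min_gen_eigenvalue (cmatrix (\<tau> *\<^sub>R D)) (cmatrix M) m) \<and>
         (\<exists>m. is_maximum (Re ` numerical_range (cmatrix Ahat)) m \<and>
              is_max_gen_eigenvalue (cmatrix (\<tau> *\<^sub>R D)) (cmatrix M) m) \<and>
         (\<exists>m. is_maximum (Im ` numerical_range (cmatrix Ahat)) m \<and>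
              is_max_gen_eigenvalue (\<tau> *\<^sub>R C) (cmatrix M) m) \<and>
         (\<exists>m. is_minimum (Im ` numerical_range (cmatrix Ahat)) m \<and>
              is_min_gen_eigenvalue (\<tau> *\<^sub>R C) (cmatrix M) m)"
proof -
  define S where "S = spd_sqrt M"
  define R where "R = matrix_inv S"
  have S: "sym_pos_def S" and SS: "S ** S = M"
    using assms(2) by (simp_all add: S_def sym_pos_def_spd_sqrt spd_sqrt_square)
  have inv: "S ** R = mat 1" "R ** S = mat 1"
    using sym_pos_def_invertible[OF S]
    by (simp_all add: R_def matrix_mul_matrix_inv matrix_inv_mul_matrix)
  have MI: "M ** matrix_inv M = mat 1"
    using sym_pos_def_invertible[OF assms(2)] by (rule matrix_mul_matrix_inv)
  have "S ** matrix_inv M = R ** (S ** S) ** matrix_inv M"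
    by (simp add: matrix_mul_assoc inv)
  also have "\<dots> = R"
    by (simp add: SS MI flip: matrix_mul_assoc)
  finally have SM: "S ** matrix_inv M = R" .
  \<comment> \<open>The similarity by \<open>S\<close> becomes a congruence of
    \<open>\<tau> K\<close> by the symmetric matrix \<open>R\<close>, because \<open>S\<close>
    absorbs one factor of the inverse of \<open>M = S ** S\<close>.\<close>
  have Ahat: "Ahat = R ** (\<tau> *\<^sub>R K) ** R"
    unfolding assms(3,4) S_def[symmetric] R_def[symmetric]
    by (simp add: matrix_scalar_ac matrix_mul_assoc SM flip: scalar_matrix_assoc)
  let ?R = "cmatrix R" and ?S = "cmatrix S" and ?K = "cmatrix (\<tau> *\<^sub>R K)"
  have cinv: "?S ** ?R = mat 1" "?R ** ?S = mat 1"
    by (simp_all add: inv cmatrix_mat_1 flip: cmatrix_mult)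
  have cM: "cmatrix M = ?S ** ?S"
    by (simp add: SS flip: cmatrix_mult)
  have RT: "transpose R = R"
    using S sym_pos_def_invertible[OF S]
    by (simp add: R_def matrix_inv_self_adjoint sym_pos_def_def)
  have "R $ i $ j = R $ j $ i" for i j
    using arg_cong[OF RT, of "\<lambda>X. X $ i $ j"] by (simp add: transpose_def)
  then have R: "x \<bullet> (?R *v y) = (?R *v x) \<bullet> y" for x y
    by (intro hermitian_self_adjoint) simp
  have D: "x \<bullet> (cmatrix (\<tau> *\<^sub>R D) *v y) = (cmatrix (\<tau> *\<^sub>R D) *v x) \<bullet> y" for x y
    by (intro hermitian_self_adjoint) (simp add: assms(5) transpose_def add.commute)
  have C: "x \<bullet> ((\<tau> *\<^sub>R C) *v y) = ((\<tau> *\<^sub>R C) *v x) \<bullet> y" for x y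
    by (intro hermitian_self_adjoint)
      (simp add: assms(6) transpose_def complex_eq_iff Re_divide Im_divide field_simps)
  \<comment> \<open>The Cartesian decomposition \<open>K = D + \<i> C\<close> with both
    \<open>D\<close> and \<open>C\<close> Hermitian.\<close>
  have K: "?K *v x = cmatrix (\<tau> *\<^sub>R D) *v x + \<i> *s ((\<tau> *\<^sub>R C) *v x)" for x
  proof -
    have "?K $ i $ j = cmatrix (\<tau> *\<^sub>R D) $ i $ j + \<i> * (\<tau> *\<^sub>R C) $ i $ j" for i j
      by (simp add: assms(5,6) transpose_def complex_eq_iff Re_divide Im_divide field_simps)
    then show ?thesis
      by (simp add: vec_eq_iff matrix_vector_mult_def sum_distrib_left algebra_simps
          flip: sum.distrib)
  qed
  \<comment> \<open>Multiplication by \<open>\<i>\<close> is skew for the real inner product and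
    commutes with \<open>H\<close>, so the form of \<open>\<i> H\<close> equals its own
    negative.\<close>
  have skew: "x \<bullet> (\<i> *s (H *v x)) = 0"
    if "\<And>x y. x \<bullet> (H *v y) = (H *v x) \<bullet> y" for H :: "complex^'n^'n" and x
  proof -
    have i: "u \<bullet> (\<i> *s w) = - ((\<i> *s u) \<bullet> w)" for u w :: "complex^'n"
      by (simp add: inner_vec_def inner_complex_def algebra_simps flip: sum_negf)
    have "x \<bullet> (\<i> *s (H *v x)) = x \<bullet> (H *v (\<i> *s x))"
      by (simp add: vector_scalar_commute)
    also have "\<dots> = - (x \<bullet> (\<i> *s (H *v x)))"
      by (metis that i inner_commute minus_minus)
    finally show ?thesis by simp
  qed
  \<comment> \<open>The scalar \<open>a\<close> handles both cases: \<open>a = 1\<close> gives the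
    real part, \<open>a = - \<i>\<close> the imaginary part.\<close>
  have Ahat_form: "x \<bullet> (a *s (cmatrix Ahat *v x)) = (?R *v x) \<bullet> (a *s (?K *v (?R *v x)))" for a x
    by (simp add: Ahat cmatrix_mult R flip: matrix_vector_mul_assoc vector_scalar_commute)
  have Re_form: "x \<bullet> (cmatrix Ahat *v x) = (?R *v x) \<bullet> (cmatrix (\<tau> *\<^sub>R D) *v (?R *v x))" for x
    using Ahat_form[of x 1] skew[OF C] by (simp add: K inner_add_right)
  have Im_form: "x \<bullet> (- \<i> *s (cmatrix Ahat *v x)) = (?R *v x) \<bullet> ((\<tau> *\<^sub>R C) *v (?R *v x))" for x
  proof -
    \<comment> \<open>The factor \<open>- \<i>\<close> exchanges the roles: now \<open>C\<close>
      carries the form and the contribution of \<open>D\<close> vanishes by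
      \<open>skew\<close>.\<close>
    have "- \<i> *s (?K *v y) = (\<tau> *\<^sub>R C) *v y - \<i> *s (cmatrix (\<tau> *\<^sub>R D) *v y)" for y
      by (simp add: K vec_eq_iff algebra_simps)
    then show ?thesis
      using Ahat_form[of x "- \<i>"] skew[OF D] by (simp add: inner_diff_right)
  qed
  show ?thesis
    unfolding Re_numerical_range Im_numerical_range Re_form Im_form cM
    using congruent_extremal_eigenvalues[OF D R cinv] congruent_extremal_eigenvalues[OF C R cinv]
    by blast
qed

end
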